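(* Let $a_0,a_1,a_2,a_3,a_4,a_5,a_6$ be arbitrary real parameters. The function $$u(x,y,t)=a_1x^2+a_2y^2+4a_1a_2t+a_0\exp\left[a_3x+(2a_2a_3^2-a_3^4)t\right]+a_4x+a_5y+a_6$$ is a solution on $\mathbb{R}^2$ (for $t\ge0$) of the equation $$u_t=\det(D^2u)-\Delta^2u.$$ Moreover: (i) the solution does not blow up in infinite time if ($a_1=0$ or $a_2=0$) and ($2a_2\le a_3^2$ or $a_3=0$); nor does it blow up in infinite time if ($a_1=0$ or $a_2=0$) and $a_0=0$; (ii) the solution blows up in infinite time if $a_1a_2\ne0$, or if $2a_2>a_3^2$, $a_3\ne0$ and $a_0\ne0$ all hold; (iii) if $a_3=0$ or $2a_2\le a_3^2$ or $a_0=0$, then for all $(x,y)\in\mathbb{R}^2$ one has $\lim_{t\nearrow\infty}u(x,y,t)=+\infty$ when $a_1a_2>0$, and $\lim_{t\nearrow\infty}u(x,y,t)=-\infty$ when $a_1a_2<0$; (iv) if $a_3\neq0$, $a_0\ne0$ and $2a_2>a_3^2$, then for all $(x,y)\in\mathbb{R}^2$ one has $\lim_{t\nearrow\infty}u(x,y,t)=+\infty$ when $a_0>0$, and $\lim_{t\nearrow\infty}u(x,y,t)=-\infty$ when $a_0<0$.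
   Context: Here $D^2u$ is the Hessian matrix with respect to the spatial variables $(x,y)$, so that $\det(D^2u)=u_{xx}u_{yy}-u_{xy}^2$, and $\Delta^2u=u_{xxxx}+2u_{xxyy}+u_{yyyy}$. "Solution" means that the (smooth) function satisfies the equation pointwise. "Blow-up in infinite time" means that $|u(x,y,t)|\to\infty$ as $t\nearrow\infty$ at points $(x,y)$ of the plane; "does not blow up in infinite time" means that at every point $(x,y)$ the function $t\mapsto u(x,y,t)$ remains bounded on $[0,\infty)$. *)

theory Defs
  imports "HOL-Analysis.Analysis"
begin

text \<open>Functions on the space-time domain are curried maps \<open>u x y t\<close>; only their values for
  \<open>t \<ge> 0\<close> matter below, and the time derivative at \<open>t = 0\<close> is one-sided.\<close>

definition spacetime :: "(real \<times> real \<times> real) set" where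
  "spacetime = UNIV \<times> UNIV \<times> {0..}"

definition Dx :: "(real \<Rightarrow> real \<Rightarrow> real \<Rightarrow> real) \<Rightarrow> real \<Rightarrow> real \<Rightarrow> real \<Rightarrow> real" where
  "Dx u x y t = deriv (\<lambda>s. u s y t) x"

definition Dy :: "(real \<Rightarrow> real \<Rightarrow> real \<Rightarrow> real) \<Rightarrow> real \<Rightarrow> real \<Rightarrow> real \<Rightarrow> real" where
  "Dy u x y t = deriv (\<lambda>s. u x s t) y"

definition Dt :: "(real \<Rightarrow> real \<Rightarrow> real \<Rightarrow> real) \<Rightarrow> real \<Rightarrow> real \<Rightarrow> real \<Rightarrow> real" where
  "Dt u x y t = vector_derivative (\<lambda>s. u x y s) (at t within {0..})"

primrec Ck :: "nat \<Rightarrow> (real \<Rightarrow> real \<Rightarrow> real \<Rightarrow> real) \<Rightarrow> bool" where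
  "Ck 0 u \<longleftrightarrow> continuous_on spacetime (\<lambda>(x, y, t). u x y t)"
| "Ck (Suc k) u \<longleftrightarrow> (\<lambda>(x, y, t). u x y t) differentiable_on spacetime
      \<and> Ck k (Dx u) \<and> Ck k (Dy u) \<and> Ck k (Dt u)"

definition smooth :: "(real \<Rightarrow> real \<Rightarrow> real \<Rightarrow> real) \<Rightarrow> bool" where
  "smooth u \<longleftrightarrow> (\<forall>k. Ck k u)"

definition hessian :: "(real \<Rightarrow> real \<Rightarrow> real \<Rightarrow> real) \<Rightarrow> real \<Rightarrow> real \<Rightarrow> real \<Rightarrow> real^2^2" where
  "hessian u x y t =
     vector [vector [Dx (Dx u) x y t, Dy (Dx u) x y t],
             vector [Dx (Dy u) x y t, Dy (Dy u) x y t]]"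

definition bilaplacian :: "(real \<Rightarrow> real \<Rightarrow> real \<Rightarrow> real) \<Rightarrow> real \<Rightarrow> real \<Rightarrow> real \<Rightarrow> real" where
  "bilaplacian u x y t =
     Dx (Dx (Dx (Dx u))) x y t + 2 * Dy (Dy (Dx (Dx u))) x y t + Dy (Dy (Dy (Dy u))) x y t"

definition is_solution :: "(real \<Rightarrow> real \<Rightarrow> real \<Rightarrow> real) \<Rightarrow> bool" where
  "is_solution u \<longleftrightarrow> smooth u \<and>
     (\<forall>x y. \<forall>t\<ge>0. Dt u x y t = det (hessian u x y t) - bilaplacian u x y t)"

definition blows_up_in_infinite_time :: "(real \<Rightarrow> real \<Rightarrow> real \<Rightarrow> real) \<Rightarrow> bool" where
  "blows_up_in_infinite_time u \<longleftrightarrow> (\<forall>x y. filterlim (\<lambda>t. \<bar>u x y t\<bar>) at_top at_top)"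

text \<open>Pointwise boundedness in time, which is stronger than the negation of
  \<^const>\<open>blows_up_in_infinite_time\<close>.\<close>

definition no_blow_up_in_infinite_time :: "(real \<Rightarrow> real \<Rightarrow> real \<Rightarrow> real) \<Rightarrow> bool" where
  "no_blow_up_in_infinite_time u \<longleftrightarrow> (\<forall>x y. bounded ((\<lambda>t. u x y t) ` {0..}))"

end

theory Submission
  imports Defs "HOL-Real_Asymp.Real_Asymp"
begin

text \<open>Write \<open>c = 2 a\<^sub>2 a\<^sub>3\<^sup>2 - a\<^sub>3\<^sup>4 = a\<^sub>3\<^sup>2 (2 a\<^sub>2 - a\<^sub>3\<^sup>2)\<close>, the growth rate of the exponential.
  The functions \<open>quadratic polynomial in x, y + multiple of t + multiple of exp (\<alpha> x + c t)\<close>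
  form a family that is closed under each of the three partial derivatives,
  so membership in the family gives smoothness by induction on the order, and all the derivatives
  in the equation are read off from the coefficients (lemmas \<open>Ck_quad_exp\<close>, \<open>Dx_quad_exp\<close>,
  \<open>Dy_quad_exp\<close>, \<open>Dt_quad_exp\<close>).

  For a fixed point \<open>(x, y)\<close> the solution is \<open>K + L t + M exp (c t)\<close> with \<open>L = 4 a\<^sub>1 a\<^sub>2\<close> and with
  \<open>M\<close> of the sign of \<open>a\<^sub>0\<close>.  If \<open>c > 0\<close> and \<open>M \<noteq> 0\<close>, the exponential dominates and the sign of \<open>M\<close>
  decides the limit; if \<open>c \<le> 0\<close> or \<open>M = 0\<close>, the exponential term is bounded for \<open>t \<ge> 0\<close>, so that
  the sign of \<open>L\<close> decides the limit and the function is bounded when \<open>L = 0\<close>.\<close>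

section \<open>A family of functions closed under partial derivatives\<close>

text \<open>A quadratic polynomial in \<open>x, y\<close> without mixed term, plus a multiple of \<open>t\<close>, plus a multiple
  of an exponential.  The coefficients \<open>\<alpha>\<close> and \<open>c\<close> of the exponent come first: differentiation
  does not change them, and acts only on the other parameters.\<close>

definition quad_exp ::
  "real \<Rightarrow> real \<Rightarrow> real \<Rightarrow> real \<Rightarrow> real \<Rightarrow> real \<Rightarrow> real \<Rightarrow> real \<Rightarrow> real \<Rightarrow> real \<Rightarrow> real \<Rightarrow> real \<Rightarrow> real"
  where
  "quad_exp \<alpha> c b p q r m n k x y t =
     p * x^2 + q * y^2 + r * t + b * exp (\<alpha> * x + c * t) + m * x + n * y + k"

text \<open>The lemmas assume and conclude equality for \<open>t \<ge> 0\<close> only, so that they can be iterated: for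
  \<open>t < 0\<close> the derivative within \<open>{0..}\<close> in \<^const>\<open>Dt\<close> has an unspecified value.\<close>

lemma Dx_quad_exp:
  assumes "\<forall>x y. \<forall>t\<ge>0. u x y t = quad_exp \<alpha> c b p q r m n k x y t"
  shows "\<forall>x y. \<forall>t\<ge>0. Dx u x y t = quad_exp \<alpha> c (b * \<alpha>) 0 0 0 (2 * p) 0 m x y t"
proof (intro allI impI)
  fix x y t :: real assume "t \<ge> 0"
  have "((\<lambda>s. quad_exp \<alpha> c b p q r m n k s y t) has_real_derivative
      quad_exp \<alpha> c (b * \<alpha>) 0 0 0 (2 * p) 0 m x y t) (at x)"
    unfolding quad_exp_def by (auto intro!: derivative_eq_intros)
  then show "Dx u x y t = quad_exp \<alpha> c (b * \<alpha>) 0 0 0 (2 * p) 0 m x y t"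
    using assms \<open>t \<ge> 0\<close> by (simp add: Dx_def DERIV_imp_deriv)
qed

lemma Dy_quad_exp:
  assumes "\<forall>x y. \<forall>t\<ge>0. u x y t = quad_exp \<alpha> c b p q r m n k x y t"
  shows "\<forall>x y. \<forall>t\<ge>0. Dy u x y t = quad_exp \<alpha> c 0 0 0 0 0 (2 * q) n x y t"
proof (intro allI impI)
  fix x y t :: real assume "t \<ge> 0"
  have "((\<lambda>s. quad_exp \<alpha> c b p q r m n k x s t) has_real_derivative
      quad_exp \<alpha> c 0 0 0 0 0 (2 * q) n x y t) (at y)"
    unfolding quad_exp_def by (auto intro!: derivative_eq_intros)
  then show "Dy u x y t = quad_exp \<alpha> c 0 0 0 0 0 (2 * q) n x y t"
    using assms \<open>t \<ge> 0\<close> by (simp add: Dy_def DERIV_imp_deriv)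
qed

lemma at_within_atLeast_neq_bot:
  fixes t :: real
  assumes "t \<ge> a"
  shows "at t within {a..} \<noteq> bot"
proof -
  have "t islimpt {t..t+1}"
    by (simp add: islimpt_Icc)
  then have "t islimpt {a..}"
    by (rule islimpt_subset) (use assms in auto)
  then show ?thesis
    by (simp add: trivial_limit_within)
qed

lemma Dt_quad_exp:
  assumes "\<forall>x y. \<forall>t\<ge>0. u x y t = quad_exp \<alpha> c b p q r m n k x y t"
  shows "\<forall>x y. \<forall>t\<ge>0. Dt u x y t = quad_exp \<alpha> c (b * c) 0 0 0 0 0 r x y t"
proof (intro allI impI)
  fix x y t :: real assume "t \<ge> 0"
  have "((\<lambda>s. quad_exp \<alpha> c b p q r m n k x y s) has_real_derivative
      quad_exp \<alpha> c (b * c) 0 0 0 0 0 r x y t) (at t within {0..})"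
    unfolding quad_exp_def by (auto intro!: derivative_eq_intros)
  then have "((\<lambda>s. quad_exp \<alpha> c b p q r m n k x y s) has_vector_derivative
      quad_exp \<alpha> c (b * c) 0 0 0 0 0 r x y t) (at t within {0..})"
    by (simp add: has_real_derivative_iff_has_vector_derivative)
  then have "((\<lambda>s. u x y s) has_vector_derivative
      quad_exp \<alpha> c (b * c) 0 0 0 0 0 r x y t) (at t within {0..})"
    by (rule has_vector_derivative_transform[rotated 2]) (use assms \<open>t \<ge> 0\<close> in auto)
  then show "Dt u x y t = quad_exp \<alpha> c (b * c) 0 0 0 0 0 r x y t"
    unfolding Dt_def using at_within_atLeast_neq_bot[OF \<open>t \<ge> 0\<close>]
    by (rule vector_derivative_within[rotated])
qed

lemma differentiable_on_quad_exp:
  assumes "\<forall>x y. \<forall>t\<ge>0. u x y t = quad_exp \<alpha> c b p q r m n k x y t"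
  shows "(\<lambda>(x, y, t). u x y t) differentiable_on spacetime"
proof -
  have "(\<lambda>(x, y, t). quad_exp \<alpha> c b p q r m n k x y t) differentiable at z within spacetime" for z
    unfolding quad_exp_def differentiable_def case_prod_unfold
    by (rule exI) (rule derivative_eq_intros refl | simp)+
  then have "(\<lambda>(x, y, t). u x y t) differentiable at z within spacetime" if "z \<in> spacetime" for z
    by (rule differentiable_transform_within[OF _ zero_less_one that])
      (auto simp: spacetime_def assms)
  then show ?thesis
    unfolding differentiable_on_def by blast
qed

lemma Ck_quad_exp:
  assumes "\<forall>x y. \<forall>t\<ge>0. u x y t = quad_exp \<alpha> c b p q r m n k x y t"
  shows "Ck j u"
  using assms
proof (induction j arbitrary: u b p q r m n k)
  case 0
  then show ?case
    using differentiable_imp_continuous_on[OF differentiable_on_quad_exp] by simp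
next
  case (Suc j)
  show ?case
    unfolding Ck.simps
  proof (intro conjI)
    show "(\<lambda>(x, y, t). u x y t) differentiable_on spacetime"
      using Suc.prems by (rule differentiable_on_quad_exp)
    show "Ck j (Dx u)"
      using Dx_quad_exp[OF Suc.prems] by (rule Suc.IH)
    show "Ck j (Dy u)"
      using Dy_quad_exp[OF Suc.prems] by (rule Suc.IH)
    show "Ck j (Dt u)"
      using Dt_quad_exp[OF Suc.prems] by (rule Suc.IH)
  qed
qed

lemma is_solution_quad_exp:
  assumes c: "c = 2 * q * \<alpha>^2 - \<alpha>^4"
  shows "is_solution (quad_exp \<alpha> c b p q (4 * p * q) m n k)"
proof -
  let ?u = "quad_exp \<alpha> c b p q (4 * p * q) m n k"
  have "Dt ?u x y t = det (hessian ?u x y t) - bilaplacian ?u x y t" if t: "t \<ge> 0" for x y t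
  proof -
    have eq: "\<forall>x y. \<forall>t\<ge>0. ?u x y t = ?u x y t"
      by simp
    note dx = Dx_quad_exp[OF eq]
    note dxx = Dx_quad_exp[OF dx]
    note dy = Dy_quad_exp[OF eq]
    note dyy = Dy_quad_exp[OF dy]
    note derivs = Dt_quad_exp[OF eq] dxx dyy Dy_quad_exp[OF dx] Dx_quad_exp[OF dy]
      Dx_quad_exp[OF Dx_quad_exp[OF dxx]] Dy_quad_exp[OF Dy_quad_exp[OF dxx]]
      Dy_quad_exp[OF Dy_quad_exp[OF dyy]]
    show ?thesis
      unfolding hessian_def bilaplacian_def det_2 vector_2 derivs[rule_format, OF t]
      by (simp add: quad_exp_def c algebra_simps power2_eq_square power4_eq_xxxx)
  qed
  then show ?thesis
    unfolding is_solution_def smooth_def using Ck_quad_exp[of ?u] by blast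
qed

section \<open>Long-time behaviour of affine plus exponential functions\<close>

lemma abs_mult_exp_le:
  fixes M c t :: real
  assumes "c \<le> 0 \<or> M = 0" "t \<ge> 0"
  shows "\<bar>M * exp (c * t)\<bar> \<le> \<bar>M\<bar>"
proof (cases "M = 0")
  case False
  then have "exp (c * t) \<le> 1"
    using assms by (simp add: mult_nonpos_nonneg)
  then show ?thesis
    by (simp add: abs_mult mult_left_le)
qed simp

lemma affine_exp_at_top_linear:
  fixes K L M c :: real
  assumes "c \<le> 0 \<or> M = 0" "L > 0"
  shows "filterlim (\<lambda>t. K + L * t + M * exp (c * t)) at_top at_top"
proof (rule filterlim_at_top_mono)
  show "filterlim (\<lambda>t. K - \<bar>M\<bar> + L * t) at_top at_top"
    using \<open>L > 0\<close> by real_asymp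
  show "\<forall>\<^sub>F t in at_top. K - \<bar>M\<bar> + L * t \<le> K + L * t + M * exp (c * t)"
    using eventually_ge_at_top[of 0]
  proof eventually_elim
    case (elim t)
    then show ?case
      using abs_mult_exp_le[OF assms(1) elim] by linarith
  qed
qed

lemma affine_exp_at_top_exp:
  fixes K L M c :: real
  assumes "c > 0" "M > 0"
  shows "filterlim (\<lambda>t. K + L * t + M * exp (c * t)) at_top at_top"
proof -
  have "filterlim (\<lambda>t. K + L * t + M * exp (c * t)) at_top at_top" if "L < 0"
    using assms that by real_asymp
  moreover have "filterlim (\<lambda>t. K + L * t + M * exp (c * t)) at_top at_top" if "L > 0"
    using assms that by real_asymp
  moreover have "filterlim (\<lambda>t. K + L * t + M * exp (c * t)) at_top at_top" if "L = 0"
    unfolding that using assms by real_asymp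
  ultimately show ?thesis
    by linarith
qed

lemma affine_exp_at_bot_linear:
  fixes K L M c :: real
  assumes "c \<le> 0 \<or> M = 0" "L < 0"
  shows "filterlim (\<lambda>t. K + L * t + M * exp (c * t)) at_bot at_top"
  using affine_exp_at_top_linear[of c "- M" "- L" "- K"] assms
  unfolding filterlim_uminus_at_bot by simp

lemma affine_exp_at_bot_exp:
  fixes K L M c :: real
  assumes "c > 0" "M < 0"
  shows "filterlim (\<lambda>t. K + L * t + M * exp (c * t)) at_bot at_top"
  using affine_exp_at_top_exp[of c "- M" "- K" "- L"] assms
  unfolding filterlim_uminus_at_bot by simp

lemma bounded_const_plus_exp:
  fixes K M c :: real
  assumes "c \<le> 0 \<or> M = 0"
  shows "bounded ((\<lambda>t. K + M * exp (c * t)) ` {0..})"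
  unfolding bounded_iff
proof (intro exI ballI)
  fix z assume "z \<in> (\<lambda>t. K + M * exp (c * t)) ` {0..}"
  then obtain t where "t \<ge> 0" "z = K + M * exp (c * t)"
    by auto
  then show "norm z \<le> \<bar>K\<bar> + \<bar>M\<bar>"
    using abs_mult_exp_le[OF assms, of t] by auto
qed

lemma growth_rate_pos_iff:
  fixes a2 a3 :: real
  shows "2 * a2 * a3^2 - a3^4 > 0 \<longleftrightarrow> a3 \<noteq> 0 \<and> 2 * a2 > a3^2"
proof -
  have "2 * a2 * a3^2 - a3^4 = a3^2 * (2 * a2 - a3^2)"
    by (simp add: algebra_simps power2_eq_square power4_eq_xxxx)
  then show ?thesis
    by (simp add: zero_less_mult_iff)
qed

section \<open>The explicit solution\<close>

theorem mainTheorem3: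
  fixes a0 a1 a2 a3 a4 a5 a6 :: real
    and u :: "real \<Rightarrow> real \<Rightarrow> real \<Rightarrow> real"
  assumes u_eq: "u = (\<lambda>x y t. a1 * x^2 + a2 * y^2 + 4 * a1 * a2 * t
      + a0 * exp (a3 * x + (2 * a2 * a3^2 - a3^4) * t) + a4 * x + a5 * y + a6)"
  shows "is_solution u
    \<and> ((a1 = 0 \<or> a2 = 0) \<and> (2 * a2 \<le> a3^2 \<or> a3 = 0) \<longrightarrow> no_blow_up_in_infinite_time u)
    \<and> ((a1 = 0 \<or> a2 = 0) \<and> a0 = 0 \<longrightarrow> no_blow_up_in_infinite_time u)
    \<and> (a1 * a2 \<noteq> 0 \<or> (2 * a2 > a3^2 \<and> a3 \<noteq> 0 \<and> a0 \<noteq> 0) \<longrightarrow> blows_up_in_infinite_time u)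
    \<and> (a3 = 0 \<or> 2 * a2 \<le> a3^2 \<or> a0 = 0 \<longrightarrow>
         (\<forall>x y. (a1 * a2 > 0 \<longrightarrow> filterlim (\<lambda>t. u x y t) at_top at_top)
              \<and> (a1 * a2 < 0 \<longrightarrow> filterlim (\<lambda>t. u x y t) at_bot at_top)))
    \<and> (a3 \<noteq> 0 \<and> a0 \<noteq> 0 \<and> 2 * a2 > a3^2 \<longrightarrow>
         (\<forall>x y. (a0 > 0 \<longrightarrow> filterlim (\<lambda>t. u x y t) at_top at_top)
              \<and> (a0 < 0 \<longrightarrow> filterlim (\<lambda>t. u x y t) at_bot at_top)))"
proof -
  define c where "c = 2 * a2 * a3^2 - a3^4"
  define K where "K x y = a1 * x^2 + a2 * y^2 + a4 * x + a5 * y + a6" for x y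
  define M where "M x = a0 * exp (a3 * x)" for x
  have u: "u x y = (\<lambda>t. K x y + (4 * a1 * a2) * t + M x * exp (c * t))" for x y
    by (simp add: u_eq K_def M_def c_def exp_add fun_eq_iff)
  have c_pos: "c > 0 \<longleftrightarrow> a3 \<noteq> 0 \<and> 2 * a2 > a3^2"
    unfolding c_def by (rule growth_rate_pos_iff)
  have M_sgn: "M x > 0 \<longleftrightarrow> a0 > 0" "M x < 0 \<longleftrightarrow> a0 < 0" "M x = 0 \<longleftrightarrow> a0 = 0" for x
    by (simp_all add: M_def zero_less_mult_iff mult_less_0_iff)

  have "u = quad_exp a3 c a0 a1 a2 (4 * a1 * a2) a4 a5 a6"
    by (simp add: u_eq quad_exp_def c_def fun_eq_iff)
  then have solution: "is_solution u"
    using is_solution_quad_exp[OF c_def] by simp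
  have bounded: "no_blow_up_in_infinite_time u" if "a1 = 0 \<or> a2 = 0" "c \<le> 0 \<or> a0 = 0"
  proof -
    have "4 * a1 * a2 = 0"
      using that(1) by auto
    then show ?thesis
      unfolding no_blow_up_in_infinite_time_def u using that(2)
      by (simp only: mult_zero_left add_0_right) (simp add: bounded_const_plus_exp M_sgn)
  qed
  have lin_top: "filterlim (\<lambda>t. u x y t) at_top at_top" if "c \<le> 0 \<or> a0 = 0" "a1 * a2 > 0" for x y
    unfolding u by (rule affine_exp_at_top_linear) (use that in \<open>auto simp: M_sgn\<close>)
  have lin_bot: "filterlim (\<lambda>t. u x y t) at_bot at_top" if "c \<le> 0 \<or> a0 = 0" "a1 * a2 < 0" for x y
    unfolding u by (rule affine_exp_at_bot_linear) (use that in \<open>auto simp: M_sgn\<close>)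
  have exp_top: "filterlim (\<lambda>t. u x y t) at_top at_top" if "c > 0" "a0 > 0" for x y
    unfolding u by (rule affine_exp_at_top_exp) (use that in \<open>auto simp: M_sgn\<close>)
  have exp_bot: "filterlim (\<lambda>t. u x y t) at_bot at_top" if "c > 0" "a0 < 0" for x y
    unfolding u by (rule affine_exp_at_bot_exp) (use that in \<open>auto simp: M_sgn\<close>)
  have blow_up: "blows_up_in_infinite_time u" if "a1 * a2 \<noteq> 0 \<or> (c > 0 \<and> a0 \<noteq> 0)"
    unfolding blows_up_in_infinite_time_def
  proof (intro allI)
    fix x y
    have "filterlim (\<lambda>t. u x y t) at_top at_top \<or> filterlim (\<lambda>t. u x y t) at_bot at_top"
      using that lin_top lin_bot exp_top exp_bot by (meson linorder_neqE not_le)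
    then show "filterlim (\<lambda>t. \<bar>u x y t\<bar>) at_top at_top"
    proof
      assume "filterlim (\<lambda>t. u x y t) at_bot at_top"
      then have "filterlim (\<lambda>t. - u x y t) at_top at_top"
        by (simp add: filterlim_uminus_at_bot)
      then show ?thesis
        using filterlim_compose[OF filterlim_abs_real] by fastforce
    qed (rule filterlim_compose[OF filterlim_abs_real])
  qed

  have c_nonpos: "c \<le> 0 \<longleftrightarrow> a3 = 0 \<or> 2 * a2 \<le> a3^2"
    using c_pos by (meson not_le)
  show ?thesis
    using solution bounded blow_up lin_top lin_bot exp_top exp_bot
    unfolding c_pos c_nonpos by blast
qed

end
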